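(* Let $(\mathsf{T},\mu,\eta)$ be a Hopf monad on a category $\mathbb{X}$ with finite biproducts. Then the following are equivalent: (i) $(\mathsf{T},\mu,\eta)$ is an idempotent monad; (ii) $\mathsf{T}$ preserves zero maps, that is, $\mathsf{T}(0)=0$ for every zero map $0$; (iii) the fusion invertor $\mathsf{h}^\circ_A:\mathsf{T}(A)\to\mathsf{T}(A\oplus\mathsf{T}(\mathsf{0}))$ is of the form $\mathsf{h}^\circ_A=\mathsf{T}(\iota_1)$ (for every object $A$), where $\iota_1:A\to A\oplus\mathsf{T}(\mathsf{0})$ is the first injection.
   Context: In a category $\mathbb{X}$ with finite biproducts, $\oplus$ denotes the biproduct, with injections $\iota_j$ and projections $\pi_j$; $\mathsf{0}$ denotes the zero object; $f+g$ denotes the sum of parallel maps and $0$ the zero maps in the induced commutative monoid enrichment (negatives are not assumed). A monad is a triple $(\mathsf{T},\mu,\eta)$ with endofunctor $\mathsf{T}$, multiplication $\mu_A:\mathsf{T}\mathsf{T}(A)\to\mathsf{T}(A)$ and unit $\eta_A:A\to\mathsf{T}(A)$. It is idempotent if $\mu$ is a natural isomorphism. The fusion operator of a monad $(\mathsf{T},\mu,\eta)$ on $\mathbb{X}$ is the natural transformation $\mathsf{h}_{A,B}:\mathsf{T}(A\oplus\mathsf{T}(B))\to\mathsf{T}(A)\oplus\mathsf{T}(B)$ defined by $\mathsf{h}_{A,B}=\iota_1\circ\mathsf{T}(\pi_1)+\iota_2\circ\mu_B\circ\mathsf{T}(\pi_2)$. The monad is a Hopf monad if $\mathsf{h}$ is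 a natural isomorphism. A fusion invertor for $(\mathsf{T},\mu,\eta)$ is a natural transformation $\mathsf{h}^\circ_A:\mathsf{T}(A)\to\mathsf{T}(A\oplus\mathsf{T}(\mathsf{0}))$ such that for every object $A$: [FI.1] $\mathsf{T}(\pi_1)\circ\mathsf{h}^\circ_A=1_{\mathsf{T}(A)}$; [FI.2] $\mu_{\mathsf{0}}\circ\mathsf{T}(\pi_2)\circ\mathsf{h}^\circ_A=0$; [FI.3] for every object $B$, $\mathsf{T}(1_A\oplus\mathsf{T}(0))\circ\mathsf{h}^\circ_A\circ\mathsf{T}(\pi_1)+\mathsf{T}(\iota_2)\circ\eta_{\mathsf{T}(B)}\circ\mu_B\circ\mathsf{T}(\pi_2)=1_{\mathsf{T}(A\oplus\mathsf{T}(B))}$, where $0:\mathsf{0}\to B$ is the zero map. Every Hopf monad on $\mathbb{X}$ has exactly one fusion invertor, namely $\mathsf{h}^\circ_A=\mathsf{h}^{-1}_{A,\mathsf{0}}\circ\iota_1$ with $\iota_1:\mathsf{T}(A)\to\mathsf{T}(A)\oplus\mathsf{T}(\mathsf{0})$; this is "the" fusion invertor. *)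

theory Defs
  imports Main "HOL-Library.FuncSet"
begin

section \<open>Categories, functors, natural transformations\<close>

record ('o, 'a) cat =
  Ob :: "'o set"
  Ar :: "'a set"
  Dom :: "'a \<Rightarrow> 'o"
  Cod :: "'a \<Rightarrow> 'o"
  Id :: "'o \<Rightarrow> 'a"
  Comp :: "'a \<Rightarrow> 'a \<Rightarrow> 'a"  (infixr \<open>\<cdot>\<index>\<close> 70)

definition hom :: "('o, 'a, 'm) cat_scheme \<Rightarrow> 'o \<Rightarrow> 'o \<Rightarrow> 'a set" where
  "hom X A B = {f \<in> Ar X. Dom X f = A \<and> Cod X f = B}"

locale category =
  fixes X (structure)
  assumes Dom_Ob: "f \<in> Ar X \<Longrightarrow> Dom X f \<in> Ob X"
    and Cod_Ob: "f \<in> Ar X \<Longrightarrow> Cod X f \<in> Ob X"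
    and Id_hom: "A \<in> Ob X \<Longrightarrow> Id X A \<in> hom X A A"
    and Comp_hom: "\<lbrakk>f \<in> hom X A B; g \<in> hom X B C\<rbrakk> \<Longrightarrow> g \<cdot> f \<in> hom X A C"
    and Comp_Id: "f \<in> hom X A B \<Longrightarrow> f \<cdot> Id X A = f"
    and Id_Comp: "f \<in> hom X A B \<Longrightarrow> Id X B \<cdot> f = f"
    and Comp_assoc:
      "\<lbrakk>f \<in> hom X A B; g \<in> hom X B C; h \<in> hom X C D\<rbrakk> \<Longrightarrow> h \<cdot> (g \<cdot> f) = (h \<cdot> g) \<cdot> f"

definition is_iso :: "('o, 'a, 'm) cat_scheme \<Rightarrow> 'a \<Rightarrow> bool" where
  "is_iso X f \<longleftrightarrow> f \<in> Ar X \<and>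
     (\<exists>g \<in> hom X (Cod X f) (Dom X f).
        g \<cdot>\<^bsub>X\<^esub> f = Id X (Dom X f) \<and> f \<cdot>\<^bsub>X\<^esub> g = Id X (Cod X f))"

definition prod_cat ::
  "('o, 'a, 'm) cat_scheme \<Rightarrow> ('p, 'b, 'n) cat_scheme \<Rightarrow> ('o \<times> 'p, 'a \<times> 'b) cat" where
  "prod_cat X Y = \<lparr>Ob = Ob X \<times> Ob Y, Ar = Ar X \<times> Ar Y,
     Dom = map_prod (Dom X) (Dom Y), Cod = map_prod (Cod X) (Cod Y),
     Id = map_prod (Id X) (Id Y),
     Comp = (\<lambda>(g, g') (f, f'). (g \<cdot>\<^bsub>X\<^esub> f, g' \<cdot>\<^bsub>Y\<^esub> f'))\<rparr>"

record ('o, 'a, 'p, 'b) fctr =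
  Fob :: "'o \<Rightarrow> 'p"
  Far :: "'a \<Rightarrow> 'b"

definition id_fctr :: "('o, 'a, 'o, 'a) fctr" where
  "id_fctr = \<lparr>Fob = (\<lambda>A. A), Far = (\<lambda>f. f)\<rparr>"

definition comp_fctr ::
  "('p, 'b, 'q, 'c) fctr \<Rightarrow> ('o, 'a, 'p, 'b) fctr \<Rightarrow> ('o, 'a, 'q, 'c) fctr" where
  "comp_fctr G F = \<lparr>Fob = (\<lambda>A. Fob G (Fob F A)), Far = (\<lambda>f. Far G (Far F f))\<rparr>"

definition is_fctr ::
  "('o, 'a, 'm) cat_scheme \<Rightarrow> ('p, 'b, 'n) cat_scheme \<Rightarrow> ('o, 'a, 'p, 'b) fctr \<Rightarrow> bool" where
  "is_fctr X Y F \<longleftrightarrow>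
     (\<forall>A \<in> Ob X. Fob F A \<in> Ob Y) \<and>
     (\<forall>A \<in> Ob X. \<forall>B \<in> Ob X. \<forall>f \<in> hom X A B. Far F f \<in> hom Y (Fob F A) (Fob F B)) \<and>
     (\<forall>A \<in> Ob X. Far F (Id X A) = Id Y (Fob F A)) \<and>
     (\<forall>A \<in> Ob X. \<forall>B \<in> Ob X. \<forall>C \<in> Ob X. \<forall>f \<in> hom X A B. \<forall>g \<in> hom X B C.
        Far F (g \<cdot>\<^bsub>X\<^esub> f) = Far F g \<cdot>\<^bsub>Y\<^esub> Far F f)"

definition nat_trans ::
  "('o, 'a, 'm) cat_scheme \<Rightarrow> ('p, 'b, 'n) cat_scheme \<Rightarrow>
   ('o, 'a, 'p, 'b) fctr \<Rightarrow> ('o, 'a, 'p, 'b) fctr \<Rightarrow> ('o \<Rightarrow> 'b) \<Rightarrow> bool" where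
  "nat_trans X Y F G \<tau> \<longleftrightarrow> is_fctr X Y F \<and> is_fctr X Y G \<and>
     (\<forall>A \<in> Ob X. \<tau> A \<in> hom Y (Fob F A) (Fob G A)) \<and>
     (\<forall>A \<in> Ob X. \<forall>B \<in> Ob X. \<forall>f \<in> hom X A B.
        \<tau> B \<cdot>\<^bsub>Y\<^esub> Far F f = Far G f \<cdot>\<^bsub>Y\<^esub> \<tau> A)"

definition nat_iso ::
  "('o, 'a, 'm) cat_scheme \<Rightarrow> ('p, 'b, 'n) cat_scheme \<Rightarrow>
   ('o, 'a, 'p, 'b) fctr \<Rightarrow> ('o, 'a, 'p, 'b) fctr \<Rightarrow> ('o \<Rightarrow> 'b) \<Rightarrow> bool" where
  "nat_iso X Y F G \<tau> \<longleftrightarrow> nat_trans X Y F G \<tau> \<and> (\<forall>A \<in> Ob X. is_iso Y (\<tau> A))"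


section \<open>Finite biproducts\<close>

text \<open>Finite biproducts are given by a zero object and binary biproducts; as usual, a choice
  of these is part of the data.  No enrichment is assumed: the sum of parallel maps is
  \<^emph>\<open>defined\<close> below from the biproducts.\<close>

record ('o, 'a) bcat = "('o, 'a) cat" +
  Zero :: 'o
  Bip :: "'o \<Rightarrow> 'o \<Rightarrow> 'o"  (infixr \<open>\<oplus>\<index>\<close> 65)
  inj1 :: "'o \<Rightarrow> 'o \<Rightarrow> 'a"
  inj2 :: "'o \<Rightarrow> 'o \<Rightarrow> 'a"
  prj1 :: "'o \<Rightarrow> 'o \<Rightarrow> 'a"
  prj2 :: "'o \<Rightarrow> 'o \<Rightarrow> 'a"

text \<open>The zero map is the composite through the zero object.\<close>

definition zero_map :: "('o, 'a, 'm) bcat_scheme \<Rightarrow> 'o \<Rightarrow> 'o \<Rightarrow> 'a" where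
  "zero_map X A B = (THE f. f \<in> hom X (Zero X) B) \<cdot>\<^bsub>X\<^esub> (THE f. f \<in> hom X A (Zero X))"

locale biproduct_category = category +
  assumes Zero_Ob: "Zero X \<in> Ob X"
    and Zero_terminal: "A \<in> Ob X \<Longrightarrow> \<exists>!f. f \<in> hom X A (Zero X)"
    and Zero_initial: "A \<in> Ob X \<Longrightarrow> \<exists>!f. f \<in> hom X (Zero X) A"
    and Bip_Ob: "\<lbrakk>A \<in> Ob X; B \<in> Ob X\<rbrakk> \<Longrightarrow> A \<oplus> B \<in> Ob X"
    and inj1_hom: "\<lbrakk>A \<in> Ob X; B \<in> Ob X\<rbrakk> \<Longrightarrow> inj1 X A B \<in> hom X A (A \<oplus> B)"
    and inj2_hom: "\<lbrakk>A \<in> Ob X; B \<in> Ob X\<rbrakk> \<Longrightarrow> inj2 X A B \<in> hom X B (A \<oplus> B)"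
    and prj1_hom: "\<lbrakk>A \<in> Ob X; B \<in> Ob X\<rbrakk> \<Longrightarrow> prj1 X A B \<in> hom X (A \<oplus> B) A"
    and prj2_hom: "\<lbrakk>A \<in> Ob X; B \<in> Ob X\<rbrakk> \<Longrightarrow> prj2 X A B \<in> hom X (A \<oplus> B) B"
    and Bip_product:
      "\<lbrakk>A \<in> Ob X; B \<in> Ob X; C \<in> Ob X; f \<in> hom X C A; g \<in> hom X C B\<rbrakk> \<Longrightarrow>
       \<exists>!h. h \<in> hom X C (A \<oplus> B) \<and> prj1 X A B \<cdot> h = f \<and> prj2 X A B \<cdot> h = g"
    and Bip_coproduct:
      "\<lbrakk>A \<in> Ob X; B \<in> Ob X; C \<in> Ob X; f \<in> hom X A C; g \<in> hom X B C\<rbrakk> \<Longrightarrow>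
       \<exists>!h. h \<in> hom X (A \<oplus> B) C \<and> h \<cdot> inj1 X A B = f \<and> h \<cdot> inj2 X A B = g"
    and prj1_inj1: "\<lbrakk>A \<in> Ob X; B \<in> Ob X\<rbrakk> \<Longrightarrow> prj1 X A B \<cdot> inj1 X A B = Id X A"
    and prj2_inj2: "\<lbrakk>A \<in> Ob X; B \<in> Ob X\<rbrakk> \<Longrightarrow> prj2 X A B \<cdot> inj2 X A B = Id X B"
    and prj1_inj2: "\<lbrakk>A \<in> Ob X; B \<in> Ob X\<rbrakk> \<Longrightarrow> prj1 X A B \<cdot> inj2 X A B = zero_map X B A"
    and prj2_inj1: "\<lbrakk>A \<in> Ob X; B \<in> Ob X\<rbrakk> \<Longrightarrow> prj2 X A B \<cdot> inj1 X A B = zero_map X A B"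

definition pairing :: "('o, 'a, 'm) bcat_scheme \<Rightarrow> 'a \<Rightarrow> 'a \<Rightarrow> 'a" where
  "pairing X f g = (THE h. h \<in> hom X (Dom X f) (Cod X f \<oplus>\<^bsub>X\<^esub> Cod X g) \<and>
     prj1 X (Cod X f) (Cod X g) \<cdot>\<^bsub>X\<^esub> h = f \<and> prj2 X (Cod X f) (Cod X g) \<cdot>\<^bsub>X\<^esub> h = g)"

definition copairing :: "('o, 'a, 'm) bcat_scheme \<Rightarrow> 'a \<Rightarrow> 'a \<Rightarrow> 'a" where
  "copairing X f g = (THE h. h \<in> hom X (Dom X f \<oplus>\<^bsub>X\<^esub> Dom X g) (Cod X f) \<and>
     h \<cdot>\<^bsub>X\<^esub> inj1 X (Dom X f) (Dom X g) = f \<and> h \<cdot>\<^bsub>X\<^esub> inj2 X (Dom X f) (Dom X g) = g)"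

definition bip_map :: "('o, 'a, 'm) bcat_scheme \<Rightarrow> 'a \<Rightarrow> 'a \<Rightarrow> 'a" where
  "bip_map X f g = pairing X (f \<cdot>\<^bsub>X\<^esub> prj1 X (Dom X f) (Dom X g))
                             (g \<cdot>\<^bsub>X\<^esub> prj2 X (Dom X f) (Dom X g))"

text \<open>The addition of the induced commutative monoid enrichment: for parallel
  \<open>f, g : A \<rightarrow> B\<close>, the composite \<open>A \<rightarrow> B \<oplus> B \<rightarrow> B\<close> of
  \<open>\<langle>f, g\<rangle>\<close> with the codiagonal.\<close>

definition sum_map :: "('o, 'a, 'm) bcat_scheme \<Rightarrow> 'a \<Rightarrow> 'a \<Rightarrow> 'a"  (infixl \<open>\<boxplus>\<index>\<close> 65) where
  "f \<boxplus>\<^bsub>X\<^esub> g = copairing X (Id X (Cod X f)) (Id X (Cod X f)) \<cdot>\<^bsub>X\<^esub> pairing X f g"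


section \<open>Hopf monads and fusion invertors\<close>

locale monad = category +
  fixes T :: "('a, 'b, 'a, 'b) fctr" and \<mu> \<eta> :: "'a \<Rightarrow> 'b"
  assumes T_fctr: "is_fctr X X T"
    and mult_nat: "nat_trans X X (comp_fctr T T) T \<mu>"
    and unit_nat: "nat_trans X X id_fctr T \<eta>"
    and mult_assoc: "A \<in> Ob X \<Longrightarrow> \<mu> A \<cdot> Far T (\<mu> A) = \<mu> A \<cdot> \<mu> (Fob T A)"
    and mult_unit_left: "A \<in> Ob X \<Longrightarrow> \<mu> A \<cdot> \<eta> (Fob T A) = Id X (Fob T A)"
    and mult_unit_right: "A \<in> Ob X \<Longrightarrow> \<mu> A \<cdot> Far T (\<eta> A) = Id X (Fob T A)"

definition idempotent_monad ::
  "('o, 'a, 'm) cat_scheme \<Rightarrow> ('o, 'a, 'o, 'a) fctr \<Rightarrow> ('o \<Rightarrow> 'a) \<Rightarrow> ('o \<Rightarrow> 'a) \<Rightarrow> bool" where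
  "idempotent_monad X T \<mu> \<eta> \<longleftrightarrow> monad X T \<mu> \<eta> \<and> nat_iso X X (comp_fctr T T) T \<mu>"

definition fusion_dom ::
  "('o, 'a, 'm) bcat_scheme \<Rightarrow> ('o, 'a, 'o, 'a) fctr \<Rightarrow> ('o \<times> 'o, 'a \<times> 'a, 'o, 'a) fctr" where
  "fusion_dom X T = \<lparr>Fob = (\<lambda>(A, B). Fob T (A \<oplus>\<^bsub>X\<^esub> Fob T B)),
                     Far = (\<lambda>(f, g). Far T (bip_map X f (Far T g)))\<rparr>"

definition fusion_cod ::
  "('o, 'a, 'm) bcat_scheme \<Rightarrow> ('o, 'a, 'o, 'a) fctr \<Rightarrow> ('o \<times> 'o, 'a \<times> 'a, 'o, 'a) fctr" where
  "fusion_cod X T = \<lparr>Fob = (\<lambda>(A, B). Fob T A \<oplus>\<^bsub>X\<^esub> Fob T B),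
                     Far = (\<lambda>(f, g). bip_map X (Far T f) (Far T g))\<rparr>"

definition fusion ::
  "('o, 'a, 'm) bcat_scheme \<Rightarrow> ('o, 'a, 'o, 'a) fctr \<Rightarrow> ('o \<Rightarrow> 'a) \<Rightarrow> 'o \<times> 'o \<Rightarrow> 'a" where
  "fusion X T \<mu> = (\<lambda>(A, B).
     inj1 X (Fob T A) (Fob T B) \<cdot>\<^bsub>X\<^esub> Far T (prj1 X A (Fob T B)) \<boxplus>\<^bsub>X\<^esub>
     inj2 X (Fob T A) (Fob T B) \<cdot>\<^bsub>X\<^esub> \<mu> B \<cdot>\<^bsub>X\<^esub> Far T (prj2 X A (Fob T B)))"

locale hopf_monad = biproduct_category X + monad X T \<mu> \<eta>
  for X (structure) and T \<mu> \<eta> +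
  assumes fusion_iso:
    "nat_iso (prod_cat X X) X (fusion_dom X T) (fusion_cod X T) (fusion X T \<mu>)"

definition fusion_invertor ::
  "('o, 'a, 'm) bcat_scheme \<Rightarrow> ('o, 'a, 'o, 'a) fctr \<Rightarrow> ('o \<Rightarrow> 'a) \<Rightarrow> ('o \<Rightarrow> 'a) \<Rightarrow>
   ('o \<Rightarrow> 'a) \<Rightarrow> bool" where
  "fusion_invertor X T \<mu> \<eta> k \<longleftrightarrow>
     nat_trans X X T
       \<lparr>Fob = (\<lambda>A. Fob T (A \<oplus>\<^bsub>X\<^esub> Fob T (Zero X))),
        Far = (\<lambda>f. Far T (bip_map X f (Id X (Fob T (Zero X)))))\<rparr> k \<and>
     (\<forall>A \<in> Ob X.
        Far T (prj1 X A (Fob T (Zero X))) \<cdot>\<^bsub>X\<^esub> k A = Id X (Fob T A) \<and>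
        \<mu> (Zero X) \<cdot>\<^bsub>X\<^esub> Far T (prj2 X A (Fob T (Zero X))) \<cdot>\<^bsub>X\<^esub> k A
          = zero_map X (Fob T A) (Fob T (Zero X)) \<and>
        (\<forall>B \<in> Ob X.
           Far T (bip_map X (Id X A) (Far T (zero_map X (Zero X) B))) \<cdot>\<^bsub>X\<^esub> k A
             \<cdot>\<^bsub>X\<^esub> Far T (prj1 X A (Fob T B)) \<boxplus>\<^bsub>X\<^esub>
           Far T (inj2 X A (Fob T B)) \<cdot>\<^bsub>X\<^esub> \<eta> (Fob T B) \<cdot>\<^bsub>X\<^esub> \<mu> B
             \<cdot>\<^bsub>X\<^esub> Far T (prj2 X A (Fob T B))
           = Id X (Fob T (A \<oplus>\<^bsub>X\<^esub> Fob T B))))"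

text \<open>A fusion invertor is unique only as a family indexed by the objects of \<open>X\<close>, so its
  values outside \<open>Ob X\<close> have to be normalised for the definite description.\<close>

definition the_fusion_invertor ::
  "('o, 'a, 'm) bcat_scheme \<Rightarrow> ('o, 'a, 'o, 'a) fctr \<Rightarrow> ('o \<Rightarrow> 'a) \<Rightarrow> ('o \<Rightarrow> 'a) \<Rightarrow>
   'o \<Rightarrow> 'a" where
  "the_fusion_invertor X T \<mu> \<eta> =
     (THE k. k \<in> extensional (Ob X) \<and> fusion_invertor X T \<mu> \<eta> k)"

definition preserves_zero_maps ::
  "('o, 'a, 'm) bcat_scheme \<Rightarrow> ('o, 'a, 'o, 'a) fctr \<Rightarrow> bool" where
  "preserves_zero_maps X T \<longleftrightarrow>
     (\<forall>A \<in> Ob X. \<forall>B \<in> Ob X. Far T (zero_map X A B) = zero_map X (Fob T A) (Fob T B))"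

end

theory Submission
  imports Defs
begin

text \<open>The fusion operator at \<open>(A, B)\<close> has the two legs \<open>T \<pi>\<^sub>1\<close> and \<open>\<mu> \<cdot> T \<pi>\<^sub>2\<close>,
  so for a Hopf monad these are jointly monic, and [FI.1] and [FI.2] say that the fusion invertor
  is the section with legs \<open>1\<close> and \<open>0\<close>.  The legs of \<open>T \<iota>\<^sub>1\<close> are \<open>1\<close> and
  \<open>\<mu> \<cdot> T 0\<close>, hence (ii) \<open>\<longleftrightarrow>\<close> (iii).  If \<open>T\<close> preserves zero maps,
  then \<open>T \<iota>\<^sub>2 \<cdot> \<eta> \<cdot> \<mu>\<close> and \<open>T \<iota>\<^sub>2\<close> have the same legs, so
  \<open>\<eta> \<cdot> \<mu> = 1\<close>.  Conversely, if \<open>\<mu>\<close> is monic, [FI.2] gives \<open>T \<pi>\<^sub>2 \<cdot> k = 0\<close>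
  for the fusion invertor \<open>k\<close>; since \<open>0 \<oplus> 1 = \<iota>\<^sub>2 \<cdot> \<pi>\<^sub>2\<close>, naturality of
  \<open>k\<close> gives \<open>k \<cdot> T 0 = 0\<close>, and [FI.1] cancels \<open>k\<close>.\<close>

section \<open>Typing and composition in a category\<close>

context category
begin

lemma in_hom_iff: "f \<in> hom X A B \<longleftrightarrow> f \<in> Ar X \<and> Dom X f = A \<and> Cod X f = B"
  by (simp add: hom_def)

lemma Comp_simps [simp]:
  assumes "f \<in> Ar X" "g \<in> Ar X" "Cod X f = Dom X g"
  shows "g \<cdot> f \<in> Ar X" "Dom X (g \<cdot> f) = Dom X f" "Cod X (g \<cdot> f) = Cod X g"
  using Comp_hom[of f "Dom X f" "Dom X g" g "Cod X g"] assms by (auto simp: in_hom_iff)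

lemma Id_simps [simp]:
  assumes "A \<in> Ob X"
  shows "Id X A \<in> Ar X" "Dom X (Id X A) = A" "Cod X (Id X A) = A"
  using Id_hom[OF assms] by (auto simp: in_hom_iff)

lemma Comp_Id_simps [simp]:
  "f \<in> Ar X \<Longrightarrow> Dom X f = A \<Longrightarrow> f \<cdot> Id X A = f"
  "f \<in> Ar X \<Longrightarrow> Cod X f = B \<Longrightarrow> Id X B \<cdot> f = f"
  using Comp_Id Id_Comp by (auto simp: in_hom_iff)

text \<open>Fixes a normal form with composites nested to the right. Where a known two-arrow
  composite stands at the left end of a longer one, later proofs use \<open>flip: assoc\<close> so
  that it becomes a subterm.\<close>

lemma assoc [simp]:
  assumes "f \<in> Ar X" "g \<in> Ar X" "h \<in> Ar X" "Cod X f = Dom X g" "Cod X g = Dom X h"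
  shows "(h \<cdot> g) \<cdot> f = h \<cdot> g \<cdot> f"
  using Comp_assoc[of f "Dom X f" "Dom X g" g "Dom X h" h "Cod X h"] assms
  by (auto simp: in_hom_iff)

declare Dom_Ob [simp] Cod_Ob [simp]

end

section \<open>Biproducts and the induced addition of maps\<close>

context biproduct_category
begin

declare Zero_Ob [simp] Bip_Ob [simp] prj1_inj1 [simp] prj2_inj2 [simp]
  prj1_inj2 [simp] prj2_inj1 [simp]

lemma biproduct_simps [simp]:
  assumes "A \<in> Ob X" "B \<in> Ob X"
  shows "inj1 X A B \<in> Ar X" "Dom X (inj1 X A B) = A" "Cod X (inj1 X A B) = A \<oplus> B"
    "inj2 X A B \<in> Ar X" "Dom X (inj2 X A B) = B" "Cod X (inj2 X A B) = A \<oplus> B"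
    "prj1 X A B \<in> Ar X" "Dom X (prj1 X A B) = A \<oplus> B" "Cod X (prj1 X A B) = A"
    "prj2 X A B \<in> Ar X" "Dom X (prj2 X A B) = A \<oplus> B" "Cod X (prj2 X A B) = B"
  using inj1_hom[OF assms] inj2_hom[OF assms] prj1_hom[OF assms] prj2_hom[OF assms]
  by (auto simp: in_hom_iff)

lemma Zero_arrows:
  assumes "A \<in> Ob X"
  shows "(THE f. f \<in> hom X (Zero X) A) \<in> hom X (Zero X) A"
    and "(THE f. f \<in> hom X A (Zero X)) \<in> hom X A (Zero X)"
  using theI'[OF Zero_initial[OF assms]] theI'[OF Zero_terminal[OF assms]] by auto

lemma zero_map_simps [simp]:
  assumes "A \<in> Ob X" "B \<in> Ob X"
  shows "zero_map X A B \<in> Ar X" "Dom X (zero_map X A B) = A" "Cod X (zero_map X A B) = B"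
  using Zero_arrows(1)[OF assms(2)] Zero_arrows(2)[OF assms(1)]
  by (auto simp: zero_map_def in_hom_iff)

text \<open>The arrow into the zero object is unique, so precomposing it with \<open>f\<close> gives
  the one starting at the domain of \<open>f\<close>.\<close>

lemma zero_map_Comp [simp]:
  assumes f: "f \<in> Ar X" "Cod X f = A" and B: "B \<in> Ob X"
  shows "zero_map X A B \<cdot> f = zero_map X (Dom X f) B"
proof -
  have A: "A \<in> Ob X" using f by auto
  let ?t = "\<lambda>A. THE f. f \<in> hom X A (Zero X)"
  have "?t A \<cdot> f \<in> hom X (Dom X f) (Zero X)"
    using Zero_arrows(2)[OF A] f by (auto simp: in_hom_iff)
  then have "?t A \<cdot> f = ?t (Dom X f)"
    using Zero_terminal[of "Dom X f"] Zero_arrows(2)[of "Dom X f"] f by auto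
  then show ?thesis
    unfolding zero_map_def
    using Zero_arrows(2)[OF A] Zero_arrows(1)[OF B] f by (simp add: in_hom_iff)
qed

lemma Comp_zero_map [simp]:
  assumes f: "f \<in> Ar X" "Dom X f = B" and A: "A \<in> Ob X"
  shows "f \<cdot> zero_map X A B = zero_map X A (Cod X f)"
proof -
  have B: "B \<in> Ob X" using f by auto
  let ?i = "\<lambda>A. THE f. f \<in> hom X (Zero X) A"
  have "f \<cdot> ?i B \<in> hom X (Zero X) (Cod X f)"
    using Zero_arrows(1)[OF B] f by (auto simp: in_hom_iff)
  then have *: "f \<cdot> ?i B = ?i (Cod X f)"
    using Zero_initial[of "Cod X f"] Zero_arrows(1)[of "Cod X f"] f by auto
  have "f \<cdot> zero_map X A B = (f \<cdot> ?i B) \<cdot> (THE f. f \<in> hom X A (Zero X))"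
    unfolding zero_map_def
    using Zero_arrows(1)[OF B] Zero_arrows(2)[OF A] f by (simp add: in_hom_iff)
  then show ?thesis by (simp add: * zero_map_def)
qed

lemma product_eqI:
  assumes "A \<in> Ob X" "B \<in> Ob X" "f \<in> hom X C (A \<oplus> B)" "g \<in> hom X C (A \<oplus> B)"
    and "prj1 X A B \<cdot> f = prj1 X A B \<cdot> g" "prj2 X A B \<cdot> f = prj2 X A B \<cdot> g"
  shows "f = g"
proof -
  have "C \<in> Ob X" "prj1 X A B \<cdot> g \<in> hom X C A" "prj2 X A B \<cdot> g \<in> hom X C B"
    using assms(1-4) by (auto simp: in_hom_iff)
  from Bip_product[OF assms(1,2) this] show ?thesis using assms(3-6) by blast
qed

lemma coproduct_eqI:
  assumes "A \<in> Ob X" "B \<in> Ob X" "f \<in> hom X (A \<oplus> B) C" "g \<in> hom X (A \<oplus> B) C"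
    and "f \<cdot> inj1 X A B = g \<cdot> inj1 X A B" "f \<cdot> inj2 X A B = g \<cdot> inj2 X A B"
  shows "f = g"
proof -
  have "C \<in> Ob X" "g \<cdot> inj1 X A B \<in> hom X A C" "g \<cdot> inj2 X A B \<in> hom X B C"
    using assms(1-4) by (auto simp: in_hom_iff)
  from Bip_coproduct[OF assms(1,2) this] show ?thesis using assms(3-6) by blast
qed

lemma pairing_simps [simp]:
  assumes "f \<in> Ar X" "g \<in> Ar X" "Dom X f = Dom X g"
  shows "pairing X f g \<in> Ar X" "Dom X (pairing X f g) = Dom X g"
    "Cod X (pairing X f g) = Cod X f \<oplus> Cod X g"
    "Cod X f = A \<Longrightarrow> Cod X g = B \<Longrightarrow> prj1 X A B \<cdot> pairing X f g = f"
    "Cod X f = A \<Longrightarrow> Cod X g = B \<Longrightarrow> prj2 X A B \<cdot> pairing X f g = g"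
  using theI'[OF Bip_product[of "Cod X f" "Cod X g" "Dom X f" f g]] assms
  by (auto simp: pairing_def in_hom_iff)

lemma copairing_simps [simp]:
  assumes "f \<in> Ar X" "g \<in> Ar X" "Cod X f = Cod X g"
  shows "copairing X f g \<in> Ar X" "Dom X (copairing X f g) = Dom X f \<oplus> Dom X g"
    "Cod X (copairing X f g) = Cod X g"
    "Dom X f = A \<Longrightarrow> Dom X g = B \<Longrightarrow> copairing X f g \<cdot> inj1 X A B = f"
    "Dom X f = A \<Longrightarrow> Dom X g = B \<Longrightarrow> copairing X f g \<cdot> inj2 X A B = g"
  using theI'[OF Bip_coproduct[of "Dom X f" "Dom X g" "Cod X f" f g]] assms
  by (auto simp: copairing_def in_hom_iff)

lemma bip_map_simps [simp]:
  assumes "f \<in> Ar X" "g \<in> Ar X"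
  shows "bip_map X f g \<in> Ar X" "Dom X (bip_map X f g) = Dom X f \<oplus> Dom X g"
    "Cod X (bip_map X f g) = Cod X f \<oplus> Cod X g"
    "Cod X f = A \<Longrightarrow> Cod X g = B \<Longrightarrow>
       prj1 X A B \<cdot> bip_map X f g = f \<cdot> prj1 X (Dom X f) (Dom X g)"
    "Cod X f = A \<Longrightarrow> Cod X g = B \<Longrightarrow>
       prj2 X A B \<cdot> bip_map X f g = g \<cdot> prj2 X (Dom X f) (Dom X g)"
  using assms by (auto simp: bip_map_def)

lemma sum_map_simps [simp]:
  assumes "f \<in> Ar X" "g \<in> Ar X" "Dom X f = Dom X g" "Cod X f = Cod X g"
  shows "f \<boxplus> g \<in> Ar X" "Dom X (f \<boxplus> g) = Dom X g" "Cod X (f \<boxplus> g) = Cod X g"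
  using assms by (auto simp: sum_map_def)

text \<open>When the second component is zero, the pairing is \<open>f\<close> followed by the first
  injection, and the codiagonal cancels that injection.\<close>

lemma sum_map_zero_right [simp]:
  assumes "f \<in> Ar X" "Dom X f = A" "Cod X f = B"
  shows "f \<boxplus> zero_map X A B = f"
proof -
  have Ob: "A \<in> Ob X" "B \<in> Ob X" using assms by auto
  have "pairing X f (zero_map X A B) = inj1 X B B \<cdot> f"
    using assms Ob
    by - (rule product_eqI[of B B _ A], auto simp: in_hom_iff simp flip: assoc)
  then show ?thesis using assms Ob by (simp add: sum_map_def flip: assoc)
qed

lemma sum_map_zero_left [simp]:
  assumes "f \<in> Ar X" "Dom X f = A" "Cod X f = B"
  shows "zero_map X A B \<boxplus> f = f"
proof -
  have Ob: "A \<in> Ob X" "B \<in> Ob X" using assms by auto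
  have "pairing X (zero_map X A B) f = inj2 X B B \<cdot> f"
    using assms Ob
    by - (rule product_eqI[of B B _ A], auto simp: in_hom_iff simp flip: assoc)
  then show ?thesis using assms Ob by (simp add: sum_map_def flip: assoc)
qed

text \<open>The pairing of the two composites is the pairing of \<open>f\<close> and
  \<open>g\<close> followed by \<open>bip_map X c c\<close>, and the codiagonal is natural with
  respect to \<open>c\<close>.\<close>

lemma Comp_sum_map:
  assumes "f \<in> Ar X" "g \<in> Ar X" "Dom X f = Dom X g" "Cod X f = Cod X g"
    and "c \<in> Ar X" "Dom X c = Cod X g"
  shows "c \<cdot> (f \<boxplus> g) = c \<cdot> f \<boxplus> c \<cdot> g"
proof -
  define B C where "B = Cod X g" and "C = Cod X c"
  have Ob: "B \<in> Ob X" "C \<in> Ob X" using assms by (auto simp: B_def C_def)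
  note BC = assms B_def[symmetric] C_def[symmetric]
  have 1: "pairing X (c \<cdot> f) (c \<cdot> g) = bip_map X c c \<cdot> pairing X f g"
    using BC Ob
    by - (rule product_eqI[of C C _ "Dom X g"], auto simp: in_hom_iff simp flip: assoc, simp_all)
  have 2: "copairing X (Id X C) (Id X C) \<cdot> bip_map X c c
      = c \<cdot> copairing X (Id X B) (Id X B)"
  proof (rule coproduct_eqI[of B B _ C])
    \<comment> \<open>\<open>bip_map\<close> is defined through the projections, so its composites
      with the injections have to be computed component by component.\<close>
    have "bip_map X c c \<cdot> inj1 X B B = inj1 X C C \<cdot> c"
      using BC Ob
      by - (rule product_eqI[of C C _ B], auto simp: in_hom_iff simp flip: assoc, simp_all)
    moreover have "bip_map X c c \<cdot> inj2 X B B = inj2 X C C \<cdot> c"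
      using BC Ob
      by - (rule product_eqI[of C C _ B], auto simp: in_hom_iff simp flip: assoc, simp_all)
    ultimately show
      "(copairing X (Id X C) (Id X C) \<cdot> bip_map X c c) \<cdot> inj1 X B B =
        (c \<cdot> copairing X (Id X B) (Id X B)) \<cdot> inj1 X B B"
      "(copairing X (Id X C) (Id X C) \<cdot> bip_map X c c) \<cdot> inj2 X B B =
        (c \<cdot> copairing X (Id X B) (Id X B)) \<cdot> inj2 X B B"
      using BC Ob by (simp_all, simp_all flip: assoc)
  qed (use BC Ob in \<open>auto simp: in_hom_iff\<close>)
  show ?thesis
    using BC Ob 2 by (simp add: sum_map_def 1 flip: assoc)
qed

end

section \<open>Monads and the characterisation of idempotence\<close>

context monad
begin

lemma Fob_Ob [simp]: "A \<in> Ob X \<Longrightarrow> Fob T A \<in> Ob X"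
  using T_fctr by (auto simp: is_fctr_def)

lemma Far_simps [simp]:
  assumes "f \<in> Ar X"
  shows "Far T f \<in> Ar X" "Dom X (Far T f) = Fob T (Dom X f)" "Cod X (Far T f) = Fob T (Cod X f)"
proof -
  have "f \<in> hom X (Dom X f) (Cod X f)" using assms by (simp add: in_hom_iff)
  then have "Far T f \<in> hom X (Fob T (Dom X f)) (Fob T (Cod X f))"
    using T_fctr Dom_Ob[OF assms] Cod_Ob[OF assms] unfolding is_fctr_def by blast
  then show "Far T f \<in> Ar X" "Dom X (Far T f) = Fob T (Dom X f)"
    "Cod X (Far T f) = Fob T (Cod X f)"
    by (simp_all add: in_hom_iff)
qed

lemma Far_Id [simp]: "A \<in> Ob X \<Longrightarrow> Far T (Id X A) = Id X (Fob T A)"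
  using T_fctr by (auto simp: is_fctr_def)

lemma Far_Comp:
  assumes "f \<in> Ar X" "g \<in> Ar X" "Cod X f = Dom X g"
  shows "Far T (g \<cdot> f) = Far T g \<cdot> Far T f"
proof -
  have "f \<in> hom X (Dom X f) (Dom X g)" "g \<in> hom X (Dom X g) (Cod X g)"
    using assms by (simp_all add: in_hom_iff)
  then show ?thesis
    using T_fctr Dom_Ob[OF assms(1)] Dom_Ob[OF assms(2)] Cod_Ob[OF assms(2)]
    unfolding is_fctr_def by blast
qed

lemma mult_simps [simp]:
  assumes "A \<in> Ob X"
  shows "\<mu> A \<in> Ar X" "Dom X (\<mu> A) = Fob T (Fob T A)" "Cod X (\<mu> A) = Fob T A"
  using mult_nat assms by (auto simp: nat_trans_def comp_fctr_def in_hom_iff)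

lemma unit_simps [simp]:
  assumes "A \<in> Ob X"
  shows "\<eta> A \<in> Ar X" "Dom X (\<eta> A) = A" "Cod X (\<eta> A) = Fob T A"
  using unit_nat assms by (auto simp: nat_trans_def id_fctr_def in_hom_iff)

lemma mult_natural:
  assumes "f \<in> Ar X" "Dom X f = A" "Cod X f = B"
  shows "\<mu> B \<cdot> Far T (Far T f) = Far T f \<cdot> \<mu> A"
proof -
  have "A \<in> Ob X" "B \<in> Ob X" "f \<in> hom X A B" using assms by (auto simp: in_hom_iff)
  then show ?thesis using mult_nat by (simp add: nat_trans_def comp_fctr_def)
qed

lemma unit_natural:
  assumes "f \<in> Ar X" "Dom X f = A" "Cod X f = B"
  shows "\<eta> B \<cdot> f = Far T f \<cdot> \<eta> A"
proof -
  have "A \<in> Ob X" "B \<in> Ob X" "f \<in> hom X A B" using assms by (auto simp: in_hom_iff)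
  then show ?thesis using unit_nat by (simp add: nat_trans_def id_fctr_def)
qed

text \<open>The unit law always makes \<open>\<eta> (Fob T A)\<close> a right inverse of
  \<open>\<mu> A\<close>, so a two-sided inverse of \<open>\<mu> A\<close> can only be this
  arrow.\<close>

lemma idempotent_monad_iff:
  "idempotent_monad X T \<mu> \<eta> \<longleftrightarrow> (\<forall>A \<in> Ob X. \<eta> (Fob T A) \<cdot> \<mu> A = Id X (Fob T (Fob T A)))"
proof
  assume idem: "idempotent_monad X T \<mu> \<eta>"
  show "\<forall>A \<in> Ob X. \<eta> (Fob T A) \<cdot> \<mu> A = Id X (Fob T (Fob T A))"
  proof
    fix A assume A: "A \<in> Ob X"
    then obtain g where g: "g \<in> hom X (Fob T A) (Fob T (Fob T A))"
        "g \<cdot> \<mu> A = Id X (Fob T (Fob T A))"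
      using idem by (auto simp: idempotent_monad_def nat_iso_def is_iso_def)
    have "g = g \<cdot> \<mu> A \<cdot> \<eta> (Fob T A)"
      using g A by (simp add: in_hom_iff mult_unit_left)
    also have "\<dots> = (g \<cdot> \<mu> A) \<cdot> \<eta> (Fob T A)"
      using g(1) A by (simp add: in_hom_iff)
    also have "\<dots> = \<eta> (Fob T A)"
      using A by (simp add: g(2))
    finally show "\<eta> (Fob T A) \<cdot> \<mu> A = Id X (Fob T (Fob T A))"
      using g by simp
  qed
next
  assume "\<forall>A \<in> Ob X. \<eta> (Fob T A) \<cdot> \<mu> A = Id X (Fob T (Fob T A))"
  then have "is_iso X (\<mu> A)" if "A \<in> Ob X" for A
    using that mult_unit_left[OF that]
    by (auto simp: is_iso_def in_hom_iff intro!: bexI[of _ "\<eta> (Fob T A)"])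
  then show "idempotent_monad X T \<mu> \<eta>"
    using mult_nat monad_axioms by (auto simp: idempotent_monad_def nat_iso_def)
qed

end

section \<open>The fusion operator and its two legs\<close>

context hopf_monad
begin

lemma fusion_simps [simp]:
  assumes "A \<in> Ob X" "B \<in> Ob X"
  shows "fusion X T \<mu> (A, B) \<in> Ar X"
    "Dom X (fusion X T \<mu> (A, B)) = Fob T (A \<oplus> Fob T B)"
    "Cod X (fusion X T \<mu> (A, B)) = Fob T A \<oplus> Fob T B"
  using assms by (auto simp: fusion_def)

text \<open>The projection distributes over the defining sum and turns the summand at the other
  injection into a zero map.\<close>

lemma prj1_fusion:
  assumes "A \<in> Ob X" "B \<in> Ob X"
  shows "prj1 X (Fob T A) (Fob T B) \<cdot> fusion X T \<mu> (A, B) = Far T (prj1 X A (Fob T B))"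
  using assms by (simp add: fusion_def Comp_sum_map flip: assoc)

lemma prj2_fusion:
  assumes "A \<in> Ob X" "B \<in> Ob X"
  shows "prj2 X (Fob T A) (Fob T B) \<cdot> fusion X T \<mu> (A, B)
    = \<mu> B \<cdot> Far T (prj2 X A (Fob T B))"
  using assms by (simp add: fusion_def Comp_sum_map flip: assoc)

lemma fusion_inverse:
  assumes "A \<in> Ob X" "B \<in> Ob X"
  obtains g where "g \<in> hom X (Fob T A \<oplus> Fob T B) (Fob T (A \<oplus> Fob T B))"
    "g \<cdot> fusion X T \<mu> (A, B) = Id X (Fob T (A \<oplus> Fob T B))"
    "fusion X T \<mu> (A, B) \<cdot> g = Id X (Fob T A \<oplus> Fob T B)"
proof -
  have "is_iso X (fusion X T \<mu> (A, B))"
    using fusion_iso assms by (auto simp: nat_iso_def prod_cat_def)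
  then show thesis using that assms by (auto simp: is_iso_def)
qed

text \<open>The two hypotheses on legs say that \<open>f\<close> and \<open>g\<close> agree after
  the fusion operator, component by component; a left inverse of the fusion operator then cancels
  it.\<close>

lemma fusion_eqI:
  assumes Ob: "A \<in> Ob X" "B \<in> Ob X"
    and f: "f \<in> Ar X" "Cod X f = Fob T (A \<oplus> Fob T B)"
    and g: "g \<in> Ar X" "Dom X g = Dom X f" "Cod X g = Fob T (A \<oplus> Fob T B)"
    and 1: "Far T (prj1 X A (Fob T B)) \<cdot> f = Far T (prj1 X A (Fob T B)) \<cdot> g"
    and 2: "\<mu> B \<cdot> Far T (prj2 X A (Fob T B)) \<cdot> f = \<mu> B \<cdot> Far T (prj2 X A (Fob T B)) \<cdot> g"
  shows "f = g"
proof -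
  let ?h = "fusion X T \<mu> (A, B)"
  have h1: "prj1 X (Fob T A) (Fob T B) \<cdot> ?h \<cdot> k = Far T (prj1 X A (Fob T B)) \<cdot> k"
    and h2: "prj2 X (Fob T A) (Fob T B) \<cdot> ?h \<cdot> k = \<mu> B \<cdot> Far T (prj2 X A (Fob T B)) \<cdot> k"
    if "k \<in> Ar X" "Cod X k = Fob T (A \<oplus> Fob T B)" for k
    using that Ob assoc[of k ?h "prj1 X (Fob T A) (Fob T B)"]
      assoc[of k ?h "prj2 X (Fob T A) (Fob T B)"]
    by (simp_all add: prj1_fusion prj2_fusion)
  have "?h \<cdot> f = ?h \<cdot> g"
    using Ob f g 1 2
    by - (rule product_eqI[of "Fob T A" "Fob T B" _ "Dom X f"], auto simp: in_hom_iff h1 h2)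
  moreover obtain i where i: "i \<in> hom X (Fob T A \<oplus> Fob T B) (Fob T (A \<oplus> Fob T B))"
    "i \<cdot> ?h = Id X (Fob T (A \<oplus> Fob T B))"
    using fusion_inverse[OF Ob] .
  moreover have "k = i \<cdot> ?h \<cdot> k" if "k \<in> Ar X" "Cod X k = Fob T (A \<oplus> Fob T B)" for k
    using that i Ob by (simp add: in_hom_iff flip: assoc)
  ultimately show ?thesis using f g by metis
qed

section \<open>Existence and uniqueness of the fusion invertor\<close>

lemma fusion_section_exists:
  assumes A: "A \<in> Ob X"
  shows "\<exists>k. k \<in> hom X (Fob T A) (Fob T (A \<oplus> Fob T (Zero X))) \<and>
    Far T (prj1 X A (Fob T (Zero X))) \<cdot> k = Id X (Fob T A) \<and>
    \<mu> (Zero X) \<cdot> Far T (prj2 X A (Fob T (Zero X))) \<cdot> k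
      = zero_map X (Fob T A) (Fob T (Zero X))"
proof -
  let ?Z = "Zero X"
  let ?h = "fusion X T \<mu> (A, ?Z)" and ?i = "inj1 X (Fob T A) (Fob T ?Z)"
  obtain g where g: "g \<in> hom X (Fob T A \<oplus> Fob T ?Z) (Fob T (A \<oplus> Fob T ?Z))"
    "?h \<cdot> g = Id X (Fob T A \<oplus> Fob T ?Z)"
    using fusion_inverse[OF A Zero_Ob] by blast
  \<comment> \<open>The witness is the inverse of the fusion operator after the first injection. By
    this equation its legs are the two projections of \<open>?i\<close>, namely the identity and the
    zero map.\<close>
  have hg: "?h \<cdot> g \<cdot> ?i = ?i"
    using g A by (simp add: in_hom_iff flip: assoc)
  have "Far T (prj1 X A (Fob T ?Z)) \<cdot> g \<cdot> ?i = prj1 X (Fob T A) (Fob T ?Z) \<cdot> ?h \<cdot> g \<cdot> ?i"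
    using g(1) A by (simp add: in_hom_iff flip: prj1_fusion)
  moreover have "\<mu> ?Z \<cdot> Far T (prj2 X A (Fob T ?Z)) \<cdot> g \<cdot> ?i
      = (\<mu> ?Z \<cdot> Far T (prj2 X A (Fob T ?Z))) \<cdot> g \<cdot> ?i"
    using g(1) A by (simp add: in_hom_iff)
  moreover have "\<dots> = prj2 X (Fob T A) (Fob T ?Z) \<cdot> ?h \<cdot> g \<cdot> ?i"
    using g(1) A by (simp add: in_hom_iff flip: prj2_fusion)
  ultimately show ?thesis
    using g(1) A by (intro exI[of _ "g \<cdot> ?i"]) (simp add: in_hom_iff hg)
qed

lemma fusion_invertorD:
  assumes "fusion_invertor X T \<mu> \<eta> k" "A \<in> Ob X"
  shows "k A \<in> Ar X" "Dom X (k A) = Fob T A" "Cod X (k A) = Fob T (A \<oplus> Fob T (Zero X))"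
    "Far T (prj1 X A (Fob T (Zero X))) \<cdot> k A = Id X (Fob T A)"
    "\<mu> (Zero X) \<cdot> Far T (prj2 X A (Fob T (Zero X))) \<cdot> k A
      = zero_map X (Fob T A) (Fob T (Zero X))"
  using assms by (auto simp: fusion_invertor_def nat_trans_def in_hom_iff)

lemma fusion_invertor_natural:
  assumes "fusion_invertor X T \<mu> \<eta> k" "f \<in> Ar X" "Dom X f = A" "Cod X f = B"
  shows "k B \<cdot> Far T f = Far T (bip_map X f (Id X (Fob T (Zero X)))) \<cdot> k A"
proof -
  have "A \<in> Ob X" "B \<in> Ob X" "f \<in> hom X A B" using assms by (auto simp: in_hom_iff)
  with assms(1) show ?thesis by (simp add: fusion_invertor_def nat_trans_def)
qed

text \<open>Naturality is read off the legs rather than from naturality of the fusion operator: both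
  sides have first leg \<open>Far T f\<close> and second leg zero.\<close>

lemma fusion_section_natural:
  assumes k: "\<And>A. A \<in> Ob X \<Longrightarrow> k A \<in> hom X (Fob T A) (Fob T (A \<oplus> Fob T (Zero X)))"
    and k1: "\<And>A. A \<in> Ob X \<Longrightarrow> Far T (prj1 X A (Fob T (Zero X))) \<cdot> k A = Id X (Fob T A)"
    and k2: "\<And>A. A \<in> Ob X \<Longrightarrow> \<mu> (Zero X) \<cdot> Far T (prj2 X A (Fob T (Zero X))) \<cdot> k A
      = zero_map X (Fob T A) (Fob T (Zero X))"
    and f: "f \<in> Ar X" "Dom X f = A" "Cod X f = B"
  shows "k B \<cdot> Far T f = Far T (bip_map X f (Id X (Fob T (Zero X)))) \<cdot> k A"
proof -
  let ?Z = "Zero X"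
  let ?b = "bip_map X f (Id X (Fob T ?Z))"
  have Ob: "A \<in> Ob X" "B \<in> Ob X" using f by auto
  note kA = k[OF Ob(1), unfolded in_hom_iff] and kB = k[OF Ob(2), unfolded in_hom_iff]
  have 1: "Far T (prj1 X B (Fob T ?Z)) \<cdot> Far T ?b = Far T f \<cdot> Far T (prj1 X A (Fob T ?Z))"
    using f Ob by (simp flip: Far_Comp)
  have 2: "Far T (prj2 X B (Fob T ?Z)) \<cdot> Far T ?b = Far T (prj2 X A (Fob T ?Z))"
    using f Ob by (simp flip: Far_Comp)
  show ?thesis
  proof (rule fusion_eqI[of B ?Z])
    have "Far T (prj1 X B (Fob T ?Z)) \<cdot> k B \<cdot> Far T f = Far T f"
      using kB k1[OF Ob(2)] f Ob by (simp flip: assoc)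
    also have "\<dots> = Far T f \<cdot> Far T (prj1 X A (Fob T ?Z)) \<cdot> k A"
      using k1[OF Ob(1)] f Ob by simp
    also have "\<dots> = (Far T (prj1 X B (Fob T ?Z)) \<cdot> Far T ?b) \<cdot> k A"
      unfolding 1 using kA f Ob by simp
    finally show "Far T (prj1 X B (Fob T ?Z)) \<cdot> k B \<cdot> Far T f
        = Far T (prj1 X B (Fob T ?Z)) \<cdot> Far T ?b \<cdot> k A"
      using kA f Ob by simp
    have "\<mu> ?Z \<cdot> Far T (prj2 X B (Fob T ?Z)) \<cdot> k B \<cdot> Far T f
        = (\<mu> ?Z \<cdot> Far T (prj2 X B (Fob T ?Z)) \<cdot> k B) \<cdot> Far T f"
      using kB f Ob by simp
    also have "\<dots> = \<mu> ?Z \<cdot> Far T (prj2 X A (Fob T ?Z)) \<cdot> k A"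
      using k2[OF Ob(1)] k2[OF Ob(2)] f Ob by simp
    also have "\<dots> = \<mu> ?Z \<cdot> (Far T (prj2 X B (Fob T ?Z)) \<cdot> Far T ?b) \<cdot> k A"
      by (simp only: 2)
    finally show "\<mu> ?Z \<cdot> Far T (prj2 X B (Fob T ?Z)) \<cdot> k B \<cdot> Far T f
        = \<mu> ?Z \<cdot> Far T (prj2 X B (Fob T ?Z)) \<cdot> Far T ?b \<cdot> k A"
      using kA f Ob by simp
  qed (use kA kB f Ob in auto)
qed

text \<open>[FI.3] follows from [FI.1] and [FI.2] for a single arrow \<open>k\<close>. The first
  summand has legs \<open>Far T ?p1\<close> and zero, the second has legs zero and
  \<open>\<mu> B \<cdot> Far T ?p2\<close>, so the sum has the legs of the identity.\<close>

lemma fusion_section_decomposition: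
  assumes Ob: "A \<in> Ob X" "B \<in> Ob X"
    and k: "k \<in> Ar X" "Dom X k = Fob T A" "Cod X k = Fob T (A \<oplus> Fob T (Zero X))"
    and k1: "Far T (prj1 X A (Fob T (Zero X))) \<cdot> k = Id X (Fob T A)"
    and k2: "\<mu> (Zero X) \<cdot> Far T (prj2 X A (Fob T (Zero X))) \<cdot> k
      = zero_map X (Fob T A) (Fob T (Zero X))"
  shows "Far T (bip_map X (Id X A) (Far T (zero_map X (Zero X) B))) \<cdot> k
             \<cdot> Far T (prj1 X A (Fob T B)) \<boxplus>
           Far T (inj2 X A (Fob T B)) \<cdot> \<eta> (Fob T B) \<cdot> \<mu> B \<cdot> Far T (prj2 X A (Fob T B))
           = Id X (Fob T (A \<oplus> Fob T B))"
    (is "Far T ?b \<cdot> k \<cdot> Far T ?p1 \<boxplus> Far T ?i2 \<cdot> \<eta> ?TB \<cdot> \<mu> B \<cdot> Far T ?p2 = _")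
proof -
  let ?Z = "Zero X"
  let ?TZ = "Fob T ?Z"
  let ?f = "Far T ?b \<cdot> k \<cdot> Far T ?p1" and ?g = "Far T ?i2 \<cdot> \<eta> ?TB \<cdot> \<mu> B \<cdot> Far T ?p2"
  have b1: "Far T ?p1 \<cdot> Far T ?b = Far T (prj1 X A ?TZ)"
    using Ob by (simp flip: Far_Comp)
  have b2: "Far T ?p2 \<cdot> Far T ?b = Far T (Far T (zero_map X ?Z B)) \<cdot> Far T (prj2 X A ?TZ)"
    using Ob by (simp flip: Far_Comp)
  have i1: "Far T ?p1 \<cdot> Far T ?i2 = Far T (zero_map X ?TB A)"
    using Ob by (simp flip: Far_Comp)
  have i2: "Far T ?p2 \<cdot> Far T ?i2 = Id X (Fob T ?TB)"
    using Ob by (simp flip: Far_Comp)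
  \<comment> \<open>Here \<open>T\<close> may fail to preserve zero maps; the composite vanishes
    because naturality of the unit moves the zero map in front of \<open>\<eta>\<close>.\<close>
  have z: "Far T (zero_map X ?TB A) \<cdot> \<eta> ?TB = zero_map X ?TB (Fob T A)"
    using unit_natural[of "zero_map X ?TB A" ?TB A] Ob by simp
  have f1: "Far T ?p1 \<cdot> ?f = Far T ?p1"
  proof -
    have "Far T ?p1 \<cdot> ?f = ((Far T ?p1 \<cdot> Far T ?b) \<cdot> k) \<cdot> Far T ?p1"
      using Ob k by simp
    then show ?thesis using Ob by (simp add: b1 k1)
  qed
  have g1: "Far T ?p1 \<cdot> ?g = zero_map X (Fob T (A \<oplus> ?TB)) (Fob T A)"
  proof -
    have "Far T ?p1 \<cdot> ?g = ((Far T ?p1 \<cdot> Far T ?i2) \<cdot> \<eta> ?TB) \<cdot> \<mu> B \<cdot> Far T ?p2"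
      using Ob by simp
    also have "\<dots> = zero_map X ?TB (Fob T A) \<cdot> \<mu> B \<cdot> Far T ?p2"
      by (simp only: i1 z)
    finally show ?thesis using Ob by simp
  qed
  have f2: "\<mu> B \<cdot> Far T ?p2 \<cdot> ?f = zero_map X (Fob T (A \<oplus> ?TB)) ?TB"
  proof -
    have "\<mu> B \<cdot> Far T ?p2 \<cdot> ?f = \<mu> B \<cdot> (Far T ?p2 \<cdot> Far T ?b) \<cdot> k \<cdot> Far T ?p1"
      using Ob k by simp
    also have "\<dots> = (\<mu> B \<cdot> Far T (Far T (zero_map X ?Z B))) \<cdot> Far T (prj2 X A ?TZ) \<cdot> k \<cdot> Far T ?p1"
      unfolding b2 using Ob k by simp
    \<comment> \<open>Naturality of \<open>\<mu>\<close> at the zero map from the zero object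
      replaces \<open>\<mu> B\<close> by \<open>\<mu> ?Z\<close>, the component occurring in
      [FI.2].\<close>
    also have "\<dots> = Far T (zero_map X ?Z B) \<cdot> (\<mu> ?Z \<cdot> Far T (prj2 X A ?TZ) \<cdot> k) \<cdot> Far T ?p1"
      using Ob k mult_natural[of "zero_map X ?Z B" ?Z B] by simp
    finally show ?thesis using Ob by (simp add: k2)
  qed
  have g2: "\<mu> B \<cdot> Far T ?p2 \<cdot> ?g = \<mu> B \<cdot> Far T ?p2"
  proof -
    have "\<mu> B \<cdot> Far T ?p2 \<cdot> ?g
        = \<mu> B \<cdot> (Far T ?p2 \<cdot> Far T ?i2) \<cdot> \<eta> ?TB \<cdot> \<mu> B \<cdot> Far T ?p2"
      using Ob by simp
    also have "\<dots> = (\<mu> B \<cdot> \<eta> ?TB) \<cdot> \<mu> B \<cdot> Far T ?p2"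
      unfolding i2 using Ob by simp
    finally show ?thesis using Ob by (simp add: mult_unit_left)
  qed
  show ?thesis
  proof (rule fusion_eqI[OF Ob])
    show "Far T ?p1 \<cdot> (?f \<boxplus> ?g) = Far T ?p1 \<cdot> Id X (Fob T (A \<oplus> ?TB))"
      using Ob k by (subst Comp_sum_map) (simp_all add: f1 g1)
    have "\<mu> B \<cdot> Far T ?p2 \<cdot> (?f \<boxplus> ?g) = (\<mu> B \<cdot> Far T ?p2) \<cdot> (?f \<boxplus> ?g)"
      using Ob k by simp
    also have "\<dots> = (\<mu> B \<cdot> Far T ?p2) \<cdot> ?f \<boxplus> (\<mu> B \<cdot> Far T ?p2) \<cdot> ?g"
      using Ob k by - (rule Comp_sum_map, simp_all)
    also have "\<dots> = \<mu> B \<cdot> Far T ?p2 \<cdot> ?f \<boxplus> \<mu> B \<cdot> Far T ?p2 \<cdot> ?g"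
      using Ob k by simp
    also have "\<dots> = \<mu> B \<cdot> Far T ?p2"
      unfolding f2 g2 using Ob by simp
    finally show "\<mu> B \<cdot> Far T ?p2 \<cdot> (?f \<boxplus> ?g) = \<mu> B \<cdot> Far T ?p2 \<cdot> Id X (Fob T (A \<oplus> ?TB))"
      using Ob by simp
  qed (use Ob k in simp_all)
qed

lemma fusion_invertor_exists:
  "\<exists>k. k \<in> extensional (Ob X) \<and> fusion_invertor X T \<mu> \<eta> k"
proof -
  obtain k0 where k0: "k0 A \<in> hom X (Fob T A) (Fob T (A \<oplus> Fob T (Zero X)))"
    "Far T (prj1 X A (Fob T (Zero X))) \<cdot> k0 A = Id X (Fob T A)"
    "\<mu> (Zero X) \<cdot> Far T (prj2 X A (Fob T (Zero X))) \<cdot> k0 A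
      = zero_map X (Fob T A) (Fob T (Zero X))" if "A \<in> Ob X" for A
    using fusion_section_exists by metis
  \<comment> \<open>The restriction meets the normalisation outside \<open>Ob X\<close> that the
    definite description asks for.\<close>
  define k where "k = restrict k0 (Ob X)"
  have k: "k A \<in> hom X (Fob T A) (Fob T (A \<oplus> Fob T (Zero X)))"
    "Far T (prj1 X A (Fob T (Zero X))) \<cdot> k A = Id X (Fob T A)"
    "\<mu> (Zero X) \<cdot> Far T (prj2 X A (Fob T (Zero X))) \<cdot> k A
      = zero_map X (Fob T A) (Fob T (Zero X))" if "A \<in> Ob X" for A
    using k0 that by (auto simp: k_def)
  let ?S = "\<lparr>Fob = (\<lambda>A. Fob T (A \<oplus> Fob T (Zero X))),
        Far = (\<lambda>f. Far T (bip_map X f (Id X (Fob T (Zero X)))))\<rparr>"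
  \<comment> \<open>\<open>nat_trans\<close> includes functoriality of its target; here this amounts
    to \<open>bip_map\<close> with a fixed identity in the second argument respecting identities and
    composition.\<close>
  have "is_fctr X X ?S"
  proof -
    have "bip_map X (Id X A) (Id X B) = Id X (A \<oplus> B)" if "A \<in> Ob X" "B \<in> Ob X" for A B
      using that by - (rule product_eqI[of A B _ "A \<oplus> B"], auto simp: in_hom_iff)
    moreover have "bip_map X (g \<cdot> f) (Id X D) = bip_map X g (Id X D) \<cdot> bip_map X f (Id X D)"
      if "f \<in> Ar X" "g \<in> Ar X" "Cod X f = Dom X g" "D \<in> Ob X" for f g D
      using that
      by - (rule product_eqI[of "Cod X g" D _ "Dom X f \<oplus> D"],
          auto simp: in_hom_iff simp flip: assoc, simp_all)
    ultimately show ?thesis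
      by (auto simp: is_fctr_def in_hom_iff Far_Comp)
  qed
  moreover have "k B \<cdot> Far T f = Far T (bip_map X f (Id X (Fob T (Zero X)))) \<cdot> k A"
    if "f \<in> hom X A B" for f A B
    using that by - (rule fusion_section_natural[of k, OF k], auto simp: in_hom_iff)
  ultimately have "nat_trans X X T ?S k"
    using T_fctr k(1) by (auto simp: nat_trans_def)
  then have "fusion_invertor X T \<mu> \<eta> k"
    using k fusion_section_decomposition by (auto simp: fusion_invertor_def in_hom_iff)
  moreover have "k \<in> extensional (Ob X)" by (simp add: k_def)
  ultimately show ?thesis by blast
qed

text \<open>[FI.1] and [FI.2] fix both legs, so they already determine the component at
  \<open>A\<close>. This serves both for uniqueness and for recognising the invertor as
  \<open>T\<close> of an injection.\<close>

lemma fusion_invertor_eqI: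
  assumes k: "fusion_invertor X T \<mu> \<eta> k" and A: "A \<in> Ob X"
    and l: "l \<in> hom X (Fob T A) (Fob T (A \<oplus> Fob T (Zero X)))"
    "Far T (prj1 X A (Fob T (Zero X))) \<cdot> l = Id X (Fob T A)"
    "\<mu> (Zero X) \<cdot> Far T (prj2 X A (Fob T (Zero X))) \<cdot> l
      = zero_map X (Fob T A) (Fob T (Zero X))"
  shows "k A = l"
  using fusion_invertorD[OF k A] l A
  by - (rule fusion_eqI[of A "Zero X"], auto simp: in_hom_iff)

text \<open>Gives the definite description its meaning: components are unique on objects, and
  extensionality turns this into equality of families.\<close>

lemma fusion_invertor_the_fusion_invertor:
  "fusion_invertor X T \<mu> \<eta> (the_fusion_invertor X T \<mu> \<eta>)"
proof -
  have "\<exists>!k. k \<in> extensional (Ob X) \<and> fusion_invertor X T \<mu> \<eta> k"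
  proof (rule ex_ex1I[OF fusion_invertor_exists])
    fix k l
    assume k: "k \<in> extensional (Ob X) \<and> fusion_invertor X T \<mu> \<eta> k"
      and l: "l \<in> extensional (Ob X) \<and> fusion_invertor X T \<mu> \<eta> l"
    show "k = l"
    proof (rule extensionalityI)
      fix A assume "A \<in> Ob X"
      with k l show "k A = l A"
        by - (rule fusion_invertor_eqI, auto simp: in_hom_iff fusion_invertorD)
    qed (use k l in auto)
  qed
  from theI'[OF this] show ?thesis by (simp add: the_fusion_invertor_def)
qed

section \<open>Idempotence, zero maps and the form of the invertor\<close>

lemma idempotent_imp_preserves_zero_maps:
  assumes "idempotent_monad X T \<mu> \<eta>"
  shows "preserves_zero_maps X T"
proof -
  let ?Z = "Zero X"
  let ?TZ = "Fob T ?Z"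
  define k where "k = the_fusion_invertor X T \<mu> \<eta>"
  have k: "fusion_invertor X T \<mu> \<eta> k"
    by (simp add: k_def fusion_invertor_the_fusion_invertor)
  \<comment> \<open>Zero endomaps come first: naturality of \<open>k\<close> at such a map has the
    same component \<open>k A\<close> on both sides.\<close>
  have zero: "Far T (zero_map X A A) = zero_map X (Fob T A) (Fob T A)" if A: "A \<in> Ob X" for A
  proof -
    note kA = fusion_invertorD[OF k A]
    let ?p1 = "prj1 X A ?TZ" and ?p2 = "prj2 X A ?TZ" and ?i2 = "inj2 X A ?TZ"
    let ?b = "bip_map X (zero_map X A A) (Id X ?TZ)"
    \<comment> \<open>Idempotence makes \<open>\<eta> ?TZ \<cdot> \<mu> ?Z\<close> an identity;
      inserting it exposes the composite that [FI.2] annihilates.\<close>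
    have "Far T ?p2 \<cdot> k A = (\<eta> ?TZ \<cdot> \<mu> ?Z) \<cdot> Far T ?p2 \<cdot> k A"
      using assms kA(1-3) A by (simp add: idempotent_monad_iff)
    also have "\<dots> = \<eta> ?TZ \<cdot> \<mu> ?Z \<cdot> Far T ?p2 \<cdot> k A"
      using kA(1-3) A by simp
    finally have p2k: "Far T ?p2 \<cdot> k A = zero_map X (Fob T A) (Fob T ?TZ)"
      using kA A by simp
    have "?b = ?i2 \<cdot> ?p2"
      using A
      by - (rule product_eqI[of A ?TZ _ "A \<oplus> ?TZ"],
          auto simp: in_hom_iff simp flip: assoc)
    then have "k A \<cdot> Far T (zero_map X A A) = (Far T ?i2 \<cdot> Far T ?p2) \<cdot> k A"
      using fusion_invertor_natural[OF k, of "zero_map X A A" A A] A by (simp add: Far_Comp)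
    also have "\<dots> = Far T ?i2 \<cdot> Far T ?p2 \<cdot> k A"
      using kA(1-3) A by simp
    also have "\<dots> = zero_map X (Fob T A) (Fob T (A \<oplus> ?TZ))"
      using A by (simp add: p2k)
    finally have kz: "k A \<cdot> Far T (zero_map X A A) = zero_map X (Fob T A) (Fob T (A \<oplus> ?TZ))" .
    have "Far T (zero_map X A A) = (Far T ?p1 \<cdot> k A) \<cdot> Far T (zero_map X A A)"
      using kA(4) A by simp
    also have "\<dots> = Far T ?p1 \<cdot> k A \<cdot> Far T (zero_map X A A)"
      using kA(1-3) A by simp
    finally show ?thesis using A by (simp add: kz)
  qed
  show ?thesis unfolding preserves_zero_maps_def
  proof (intro ballI)
    fix A B assume Ob: "A \<in> Ob X" "B \<in> Ob X"
    \<comment> \<open>A zero map absorbs a zero endomap of its domain, which reduces the general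
      case to the one just proved.\<close>
    then have "Far T (zero_map X A B) = Far T (zero_map X A B) \<cdot> Far T (zero_map X A A)"
      by (simp flip: Far_Comp)
    then show "Far T (zero_map X A B) = zero_map X (Fob T A) (Fob T B)"
      using Ob by (simp add: zero)
  qed
qed

lemma preserves_zero_maps_imp_idempotent:
  assumes "preserves_zero_maps X T"
  shows "idempotent_monad X T \<mu> \<eta>"
  unfolding idempotent_monad_iff
proof
  fix A assume A: "A \<in> Ob X"
  let ?TA = "Fob T A"
  let ?p1 = "prj1 X A ?TA" and ?p2 = "prj2 X A ?TA" and ?i2 = "inj2 X A ?TA"
  let ?e = "\<eta> ?TA \<cdot> \<mu> A"
  have p1: "Far T ?p1 \<cdot> Far T ?i2 = zero_map X (Fob T ?TA) (Fob T A)"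
    using A assms by (simp add: preserves_zero_maps_def flip: Far_Comp)
  have p2: "Far T ?p2 \<cdot> Far T ?i2 = Id X (Fob T ?TA)"
    using A by (simp flip: Far_Comp)
  have \<mu>e: "\<mu> A \<cdot> ?e = \<mu> A"
    using A mult_unit_left[OF A] by (simp flip: assoc)
  have cancel: "Far T ?p2 \<cdot> Far T ?i2 \<cdot> f = f" if "f \<in> Ar X" "Cod X f = Fob T ?TA" for f
    using that A p2 by (simp flip: assoc)
  \<comment> \<open>Comparison by legs needs a codomain of the form
    \<open>Fob T (A \<oplus> Fob T A)\<close>. The arrow \<open>Far T ?i2\<close> carries
    \<open>?e\<close> there, and its retraction \<open>Far T ?p2\<close> brings the equation
    back.\<close>
  have "Far T ?i2 \<cdot> ?e = Far T ?i2"
  proof (rule fusion_eqI[OF A A])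
    have "Far T ?p1 \<cdot> Far T ?i2 \<cdot> ?e = (Far T ?p1 \<cdot> Far T ?i2) \<cdot> ?e"
      using A by simp
    then show "Far T ?p1 \<cdot> Far T ?i2 \<cdot> ?e = Far T ?p1 \<cdot> Far T ?i2"
      using A by (simp add: p1)
    show "\<mu> A \<cdot> Far T ?p2 \<cdot> Far T ?i2 \<cdot> ?e = \<mu> A \<cdot> Far T ?p2 \<cdot> Far T ?i2"
      using A cancel[of ?e] by (simp add: p2 \<mu>e)
  qed (use A in simp_all)
  then show "?e = Id X (Fob T ?TA)"
    using A cancel[of ?e] p2 by simp
qed

lemma preserves_zero_maps_iff_the_fusion_invertor:
  "preserves_zero_maps X T \<longleftrightarrow>
    (\<forall>A \<in> Ob X. the_fusion_invertor X T \<mu> \<eta> A = Far T (inj1 X A (Fob T (Zero X))))"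
proof -
  let ?Z = "Zero X"
  let ?TZ = "Fob T ?Z"
  have p1: "Far T (prj1 X A ?TZ) \<cdot> Far T (inj1 X A ?TZ) = Id X (Fob T A)"
    and p2: "Far T (prj2 X A ?TZ) \<cdot> Far T (inj1 X A ?TZ) = Far T (zero_map X A ?TZ)"
    if "A \<in> Ob X" for A
    using that by (simp_all flip: Far_Comp)
  show ?thesis
  proof
    assume zero: "preserves_zero_maps X T"
    show "\<forall>A \<in> Ob X. the_fusion_invertor X T \<mu> \<eta> A = Far T (inj1 X A ?TZ)"
    proof
      fix A assume "A \<in> Ob X"
      then show "the_fusion_invertor X T \<mu> \<eta> A = Far T (inj1 X A ?TZ)"
        using zero
        by - (rule fusion_invertor_eqI[OF fusion_invertor_the_fusion_invertor],
            simp_all add: in_hom_iff p1 p2 preserves_zero_maps_def)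
    qed
  next
    assume inv: "\<forall>A \<in> Ob X. the_fusion_invertor X T \<mu> \<eta> A = Far T (inj1 X A ?TZ)"
    have terminal: "Far T (zero_map X A ?Z) = zero_map X (Fob T A) ?TZ" if A: "A \<in> Ob X" for A
    proof -
      \<comment> \<open>For \<open>T\<close> of the injection, [FI.2] says only that
        \<open>\<mu> ?Z\<close> kills \<open>T\<close> of the zero map into \<open>?TZ\<close>.
        Factoring that map through \<open>\<eta> ?Z\<close> and using the right unit law recovers
        \<open>T\<close> of the zero map into \<open>?Z\<close>.\<close>
      have "Far T (zero_map X A ?TZ) = Far T (\<eta> ?Z) \<cdot> Far T (zero_map X A ?Z)"
        using A by (simp flip: Far_Comp)
      then have "\<mu> ?Z \<cdot> Far T (zero_map X A ?TZ) = (\<mu> ?Z \<cdot> Far T (\<eta> ?Z)) \<cdot> Far T (zero_map X A ?Z)"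
        using A by simp
      then have "Far T (zero_map X A ?Z) = \<mu> ?Z \<cdot> Far T (zero_map X A ?TZ)"
        using A by (simp add: mult_unit_right)
      also have "\<dots> = zero_map X (Fob T A) ?TZ"
        using fusion_invertorD(5)[OF fusion_invertor_the_fusion_invertor A] inv A
        by (simp add: p2)
      finally show ?thesis .
    qed
    show "preserves_zero_maps X T" unfolding preserves_zero_maps_def
    proof (intro ballI)
      fix A B assume Ob: "A \<in> Ob X" "B \<in> Ob X"
      \<comment> \<open>Every zero map factors through the zero object, so the case of codomain
        \<open>?Z\<close> suffices.\<close>
      then have "Far T (zero_map X A B) = Far T (zero_map X ?Z B) \<cdot> Far T (zero_map X A ?Z)"
        by (simp flip: Far_Comp)
      then show "Far T (zero_map X A B) = zero_map X (Fob T A) (Fob T B)"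
        using Ob by (simp add: terminal)
    qed
  qed
qed

end

theorem lemma5p2:
  fixes X :: "('o, 'a) bcat"
    and T :: "('o, 'a, 'o, 'a) fctr"
    and \<mu> \<eta> :: "'o \<Rightarrow> 'a"
  assumes "hopf_monad X T \<mu> \<eta>"
  shows "(idempotent_monad X T \<mu> \<eta> \<longleftrightarrow> preserves_zero_maps X T) \<and>
         (preserves_zero_maps X T \<longleftrightarrow>
           (\<forall>A \<in> Ob X. the_fusion_invertor X T \<mu> \<eta> A = Far T (inj1 X A (Fob T (Zero X)))))"
proof -
  interpret hopf_monad X T \<mu> \<eta> by fact
  show ?thesis
    using idempotent_imp_preserves_zero_maps preserves_zero_maps_imp_idempotent
      preserves_zero_maps_iff_the_fusion_invertor by blast
qed

end
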